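(* Let $0<\alpha<1$, let $U=\prod_{i=1}^d[0,b_i]\subset\mathbb{R}^d$ with all $b_i>0$, and let $A=(a_{ij})\in\mathbb{R}^{d\times d}$. Assume that each row functional $$L_r(x):=(Ax)_r=\sum_{j=1}^d a_{rj}x_j$$ is nonnegative on $U$, so that $L_r(x)^\alpha$ is real-valued on $U$. For $r=1,\dots,d$ set $$Y_r^\alpha(x):=\frac{L_r(x)^\alpha}{\Gamma(1+\alpha)}.$$ Assume that, for every $r$, the function $Y_r^\alpha$ on $U$ lies in the real linear span of $X_1^\alpha,\dots,X_d^\alpha$, where $X_j^\alpha(x)=x_j^\alpha/\Gamma(1+\alpha)$. Then each row of $A$ contains at most one nonzero entry. In particular, if $A$ is invertible, then $A=DP$, where $D$ is a positive diagonal matrix (diagonal with strictly positive diagonal entries) and $P$ is a permutation matrix. Conversely, every such matrix $DP$ preserves the linear span of $X_1^\alpha,\dots,X_d^\alpha$; that is, for $A=DP$ with $D$ positive diagonal and $P$ a permutation matrix, the span of the corresponding functions $Y_1^\alpha,\dots,Y_d^\alpha$ equals the span of $X_1^\alpha,\dots,X_d^\alpha$. *)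

theory Defs
  imports "HOL-Analysis.Analysis" "HOL-Library.FuncSet"
begin

definition X_fun :: "real \<Rightarrow> 'n \<Rightarrow> real ^ 'n \<Rightarrow> real"
  where "X_fun \<alpha> j x = (x $ j) powr \<alpha> / Gamma (1 + \<alpha>)"

definition Y_fun :: "real \<Rightarrow> real ^ 'n ^ 'n \<Rightarrow> 'n::finite \<Rightarrow> real ^ 'n \<Rightarrow> real"
  where "Y_fun \<alpha> A r x = ((A *v x) $ r) powr \<alpha> / Gamma (1 + \<alpha>)"

(* A function on U is represented by its extensional restriction, so that functions
   are compared through their values on U only. *)
definition lin_span_on :: "'a set \<Rightarrow> ('i::finite \<Rightarrow> 'a \<Rightarrow> real) \<Rightarrow> ('a \<Rightarrow> real) set"
  where "lin_span_on U F = {restrict (\<lambda>x. \<Sum>j\<in>UNIV. c j * F j x) U | c. True}"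

definition positive_diagonal :: "real ^ 'n ^ 'n \<Rightarrow> bool"
  where "positive_diagonal D \<longleftrightarrow>
    (\<forall>i j. i \<noteq> j \<longrightarrow> D $ i $ j = 0) \<and> (\<forall>i. D $ i $ i > 0)"

definition permutation_matrix :: "real ^ 'n ^ 'n \<Rightarrow> bool"
  where "permutation_matrix P \<longleftrightarrow>
    (\<exists>\<sigma>. bij \<sigma> \<and> P = (\<chi> i j. if j = \<sigma> i then 1 else 0))"

end

theory Submission
  imports Defs
begin

text \<open>
  The whole rigidity statement is strict subadditivity of the map sending \<open>t\<close> to \<open>t powr \<alpha>\<close>
  for \<open>0 < \<alpha> < 1\<close> (lemma \<open>powr_add_strict_subadditive\<close>). Functions in the span of the
  powers \<open>(x $ j) powr \<alpha>\<close> are additive over coordinates: their value at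
  \<open>axis p s + axis q t\<close>, \<open>p \<noteq> q\<close>, is the sum of their values at \<open>axis p s\<close> and
  \<open>axis q t\<close>. If a row had nonzero entries in columns \<open>p\<close> and \<open>q\<close>, then the row functional
  would take positive values \<open>u\<close> and \<open>v\<close> at the two edge ends \<open>axis p (b $ p)\<close> and
  \<open>axis q (b $ q)\<close> of the box and \<open>u + v\<close> at their sum, which is again in the box. Additivity would
  give \<open>(u + v) powr \<alpha> = u powr \<alpha> + v powr \<alpha>\<close>, which is impossible. Three points of the box
  therefore decide the matter (lemma \<open>row_support_of_powr_in_span\<close>).

  An invertible matrix has no zero row and no zero column, so having at most one nonzero
  entry per row means that the positions of these entries form a permutation; nonnegativity on the box makes
  the entries positive. Conversely, a positive diagonal matrix times a permutation matrix
  rescales and permutes the functions \<open>X_fun \<alpha> j\<close>, which leaves their span unchanged.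
\<close>

section \<open>Strict subadditivity of fractional powers\<close>

text \<open>
  The shares \<open>u / (u + v)\<close> and \<open>v / (u + v)\<close> lie strictly between 0 and 1, so raising them to a
  power below 1 increases both, and the shares add up to 1.
\<close>

lemma powr_add_strict_subadditive:
  fixes u v \<alpha> :: real
  assumes "\<alpha> < 1" "0 < u" "0 < v"
  shows "(u + v) powr \<alpha> < u powr \<alpha> + v powr \<alpha>"
proof -
  have share: "w / (u + v) * (u + v) powr \<alpha> < w powr \<alpha>" if "0 < w" "w < u + v" for w
  proof -
    have "(w / (u + v)) powr 1 < (w / (u + v)) powr \<alpha>"
      using that assms by (intro powr_less_mono') auto
    then have "w / (u + v) < w powr \<alpha> / (u + v) powr \<alpha>"
      using that assms by (simp add: powr_divide)
    then show ?thesis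
      using assms by (simp add: pos_less_divide_eq)
  qed
  have "(u + v) powr \<alpha> = u / (u + v) * (u + v) powr \<alpha> + v / (u + v) * (u + v) powr \<alpha>"
    using assms by (simp add: distrib_right[symmetric] add_divide_distrib[symmetric])
  also have "\<dots> < u powr \<alpha> + v powr \<alpha>"
    using share[of u] share[of v] assms by simp
  finally show ?thesis .
qed

section \<open>Rows of a matrix whose powers stay in the span\<close>

lemma matrix_vector_mult_axis_nth:
  fixes A :: "real ^ 'n ^ 'm"
  shows "(A *v axis j s) $ r = A $ r $ j * s"
  by (simp add: matrix_vector_mult_def axis_def if_distrib cong: if_cong)

lemma row_nonneg_imp_entry_nonneg:
  fixes A :: "real ^ 'n ^ 'n"
  assumes b: "\<And>i. 0 < b $ i"
    and nonneg: "\<And>x. x \<in> cbox 0 b \<Longrightarrow> 0 \<le> (A *v x) $ r"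
  shows "0 \<le> A $ r $ j"
proof -
  have "axis j (b $ j) \<in> cbox 0 b"
    using b by (auto simp: mem_box_cart axis_def less_imp_le)
  from nonneg[OF this] have "0 \<le> A $ r $ j * b $ j"
    by (simp add: matrix_vector_mult_axis_nth)
  then show ?thesis
    using b[of j] by (simp add: zero_le_mult_iff)
qed

text \<open>
  At the three points \<open>axis p (b $ p)\<close>, \<open>axis q (b $ q)\<close> and their sum, membership in the span
  forces equality in the strict inequality above.
\<close>

lemma row_support_of_powr_in_span:
  fixes A :: "real ^ 'n ^ 'n"
  assumes \<alpha>: "0 < \<alpha>" "\<alpha> < 1"
    and b: "\<And>i. 0 < b $ i"
    and nonneg: "\<And>x. x \<in> cbox 0 b \<Longrightarrow> 0 \<le> (A *v x) $ r"
    and span: "restrict (Y_fun \<alpha> A r) (cbox 0 b) \<in> lin_span_on (cbox 0 b) (X_fun \<alpha>)"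
    and p: "A $ r $ p \<noteq> 0" and q: "A $ r $ q \<noteq> 0"
  shows "p = q"
proof (rule ccontr)
  assume "p \<noteq> q"
  obtain c where c: "restrict (Y_fun \<alpha> A r) (cbox 0 b)
      = restrict (\<lambda>x. \<Sum>j\<in>UNIV. c j * X_fun \<alpha> j x) (cbox 0 b)"
    using span by (auto simp: lin_span_on_def)
  have "Gamma (1 + \<alpha>) > 0"
    using \<alpha> by (intro Gamma_real_pos) auto
  then have powr_eq: "((A *v x) $ r) powr \<alpha> = (\<Sum>j\<in>UNIV. c j * (x $ j) powr \<alpha>)"
    if "x \<in> cbox 0 b" for x
    using fun_cong[OF c, of x] that
    by (simp add: X_fun_def Y_fun_def sum_divide_distrib[symmetric])
  define u where "u = A $ r $ p * b $ p"
  define v where "v = A $ r $ q * b $ q"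
  have "0 < u" "0 < v"
    using p q b row_nonneg_imp_entry_nonneg[OF b nonneg]
    unfolding u_def v_def by (simp_all add: less_le)
  have edge: "(A $ r $ i * b $ i) powr \<alpha> = c i * (b $ i) powr \<alpha>" for i
  proof -
    have "axis i (b $ i) \<in> cbox 0 b"
      using b by (auto simp: mem_box_cart axis_def less_imp_le)
    from powr_eq[OF this] show ?thesis
      by (simp add: matrix_vector_mult_axis_nth)
        (simp add: axis_def if_distrib if_distribR cong: if_cong)
  qed
  let ?z = "axis p (b $ p) + axis q (b $ q)"
  have "?z \<in> cbox 0 b"
    using b \<open>p \<noteq> q\<close> by (auto simp: mem_box_cart axis_def less_imp_le)
  moreover have "(A *v ?z) $ r = u + v"
    by (simp add: matrix_vector_right_distrib matrix_vector_mult_axis_nth u_def v_def)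
  moreover have "(\<Sum>j\<in>UNIV. c j * (?z $ j) powr \<alpha>)
      = (\<Sum>j\<in>UNIV. (if j = p then c p * (b $ p) powr \<alpha> else 0)
          + (if j = q then c q * (b $ q) powr \<alpha> else 0))"
    using \<open>p \<noteq> q\<close> by (intro sum.cong) (auto simp: axis_def)
  ultimately have "(u + v) powr \<alpha> = c p * (b $ p) powr \<alpha> + c q * (b $ q) powr \<alpha>"
    using powr_eq[of ?z] by (simp add: sum.distrib)
  also have "\<dots> = u powr \<alpha> + v powr \<alpha>"
    using edge by (simp add: u_def v_def)
  finally show False
    using powr_add_strict_subadditive[OF \<open>\<alpha> < 1\<close> \<open>0 < u\<close> \<open>0 < v\<close>] by simp
qed

section \<open>Generalized permutation matrices\<close>

lemma diagonal_times_permutation_nth: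
  fixes D :: "real ^ 'n ^ 'n"
  assumes "\<And>i j. i \<noteq> j \<Longrightarrow> D $ i $ j = 0"
  shows "(D ** (\<chi> i j. if j = \<sigma> i then 1 else 0)) $ r $ k = (if k = \<sigma> r then D $ r $ r else 0)"
proof -
  have "(D ** (\<chi> i j. if j = \<sigma> i then 1 else 0)) $ r $ k
      = (\<Sum>i\<in>UNIV. D $ r $ i * (if k = \<sigma> i then 1 else 0))"
    by (simp add: matrix_matrix_mult_def)
  also have "\<dots> = (\<Sum>i\<in>UNIV. if i = r then (if k = \<sigma> r then D $ r $ r else 0) else 0)"
    using assms by (intro sum.cong) auto
  finally show ?thesis by simp
qed

text \<open>
  A zero row or a zero column would make a diagonal entry of \<open>A ** A'\<close> or of \<open>A' ** A\<close> vanish.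
  Hence the map from a row to the column of its nonzero entry is total and surjective, and on a
  finite index type surjectivity gives bijectivity.
\<close>

lemma invertible_nonneg_monomial_decomposition:
  fixes A :: "real ^ 'n ^ 'n"
  assumes inv: "invertible A"
    and nonneg: "\<And>i j. 0 \<le> A $ i $ j"
    and unique: "\<And>r p q. A $ r $ p \<noteq> 0 \<Longrightarrow> A $ r $ q \<noteq> 0 \<Longrightarrow> p = q"
  shows "\<exists>D P. positive_diagonal D \<and> permutation_matrix P \<and> A = D ** P"
proof -
  obtain A' where right: "A ** A' = mat 1" and left: "A' ** A = mat 1"
    using inv by (auto simp: invertible_def)
  have row: "\<exists>j. A $ r $ j \<noteq> 0" for r
  proof (rule ccontr)
    assume "\<not> ?thesis"
    then have "(A ** A') $ r $ r = 0" by (simp add: matrix_matrix_mult_def)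
    then show False by (simp add: right mat_def)
  qed
  have column: "\<exists>i. A $ i $ k \<noteq> 0" for k
  proof (rule ccontr)
    assume "\<not> ?thesis"
    then have "(A' ** A) $ k $ k = 0" by (simp add: matrix_matrix_mult_def)
    then show False by (simp add: left mat_def)
  qed
  obtain \<sigma> where \<sigma>: "\<And>r. A $ r $ \<sigma> r \<noteq> 0"
    using row by metis
  have "surj \<sigma>"
    using column \<sigma> unique by (metis surj_def)
  then have "bij \<sigma>"
    by (simp add: bij_def finite_UNIV_surj_inj)
  define D :: "real ^ 'n ^ 'n" where "D = (\<chi> i j. if i = j then A $ i $ \<sigma> i else 0)"
  define P :: "real ^ 'n ^ 'n" where "P = (\<chi> i j. if j = \<sigma> i then 1 else 0)"
  have "positive_diagonal D"
    using \<sigma> nonneg by (simp add: positive_diagonal_def D_def less_le)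
  moreover have "permutation_matrix P"
    using \<open>bij \<sigma>\<close> by (auto simp: permutation_matrix_def P_def)
  moreover have "A $ r $ k = (D ** P) $ r $ k" for r k
    unfolding P_def using \<sigma> unique
    by (subst diagonal_times_permutation_nth) (auto simp: D_def)
  then have "A = D ** P"
    by (simp add: vec_eq_iff)
  ultimately show ?thesis by blast
qed

section \<open>Invariance of the span\<close>

lemma combination_in_lin_span_on:
  "restrict (\<lambda>x. \<Sum>j\<in>UNIV. c j * F j x) U \<in> lin_span_on U F"
  by (auto simp: lin_span_on_def)

text \<open>
  Coefficients \<open>c\<close> for \<open>F\<close> and \<open>c'\<close> for \<open>G\<close> give the same function once
  \<open>c r * w r = c' (\<sigma> r)\<close>; since \<open>\<sigma>\<close> is bijective and \<open>w\<close> has no zero, this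
  relation can be solved for either family in terms of the other.
\<close>

lemma lin_span_on_rescale_permute:
  assumes \<sigma>: "bij \<sigma>"
    and w: "\<And>r. w r \<noteq> 0"
    and F: "\<And>r x. x \<in> U \<Longrightarrow> F r x = w r * G (\<sigma> r) x"
  shows "lin_span_on U F = lin_span_on U G"
proof -
  have combination: "restrict (\<lambda>x. \<Sum>r\<in>UNIV. c r * F r x) U
      = restrict (\<lambda>x. \<Sum>j\<in>UNIV. c' j * G j x) U"
    if "\<And>r. c r * w r = c' (\<sigma> r)" for c c'
  proof (rule restrict_ext)
    fix x assume "x \<in> U"
    then have "(\<Sum>r\<in>UNIV. c r * F r x) = (\<Sum>r\<in>UNIV. c' (\<sigma> r) * G (\<sigma> r) x)"
      by (simp add: F that[symmetric] mult.assoc)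
    also have "\<dots> = (\<Sum>j\<in>UNIV. c' j * G j x)"
      using \<sigma> by (rule sum.reindex_bij_betw)
    finally show "(\<Sum>r\<in>UNIV. c r * F r x) = (\<Sum>j\<in>UNIV. c' j * G j x)" .
  qed
  show ?thesis
  proof (intro equalityI subsetI)
    fix f assume "f \<in> lin_span_on U F"
    then obtain c where f: "f = restrict (\<lambda>x. \<Sum>r\<in>UNIV. c r * F r x) U"
      by (auto simp: lin_span_on_def)
    let ?c' = "\<lambda>j. c (inv \<sigma> j) * w (inv \<sigma> j)"
    have "f = restrict (\<lambda>x. \<Sum>j\<in>UNIV. ?c' j * G j x) U"
      unfolding f using \<sigma> by (intro combination) (simp add: bij_is_inj)
    also have "\<dots> \<in> lin_span_on U G"
      by (rule combination_in_lin_span_on)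
    finally show "f \<in> lin_span_on U G" .
  next
    fix f assume "f \<in> lin_span_on U G"
    then obtain c' where f: "f = restrict (\<lambda>x. \<Sum>j\<in>UNIV. c' j * G j x) U"
      by (auto simp: lin_span_on_def)
    let ?c = "\<lambda>r. c' (\<sigma> r) / w r"
    have "f = restrict (\<lambda>x. \<Sum>r\<in>UNIV. ?c r * F r x) U"
      unfolding f using w by (intro combination[symmetric]) simp
    also have "\<dots> \<in> lin_span_on U F"
      by (rule combination_in_lin_span_on)
    finally show "f \<in> lin_span_on U F" .
  qed
qed

lemma lin_span_on_generalized_permutation:
  fixes D P :: "real ^ 'n ^ 'n"
  assumes D: "positive_diagonal D" and P: "permutation_matrix P"
    and U: "\<And>x i. x \<in> U \<Longrightarrow> 0 \<le> x $ i"
  shows "lin_span_on U (Y_fun \<alpha> (D ** P)) = lin_span_on U (X_fun \<alpha>)"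
proof -
  obtain \<sigma> where \<sigma>: "bij \<sigma>" and P_eq: "P = (\<chi> i j. if j = \<sigma> i then 1 else 0)"
    using P by (auto simp: permutation_matrix_def)
  have pos: "0 < D $ r $ r" for r
    using D by (simp add: positive_diagonal_def)
  have entry: "(D ** P) $ r $ k = (if k = \<sigma> r then D $ r $ r else 0)" for r k
    unfolding P_eq using D by (intro diagonal_times_permutation_nth) (simp add: positive_diagonal_def)
  have "((D ** P) *v x) $ r = D $ r $ r * x $ \<sigma> r" for x r
    by (simp add: matrix_vector_mult_def[of "D ** P"] entry if_distribR if_distrib cong: if_cong)
  then have "Y_fun \<alpha> (D ** P) r x = (D $ r $ r) powr \<alpha> * X_fun \<alpha> (\<sigma> r) x" if "x \<in> U" for r x
    using U[OF that] pos by (simp add: Y_fun_def X_fun_def powr_mult less_imp_le)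
  then show ?thesis
    using pos by (intro lin_span_on_rescale_permute[OF \<sigma>, where w = "\<lambda>r. (D $ r $ r) powr \<alpha>"])
      (auto simp: less_le)
qed

section \<open>The rigidity theorem\<close>

theorem proposition6p5:
  fixes \<alpha> :: real and b :: "real ^ 'n" and U :: "(real ^ 'n) set"
  assumes "0 < \<alpha>" and "\<alpha> < 1"
    and "\<And>i. b $ i > 0"
    and "U = cbox 0 b"
  shows "(\<forall>A :: real ^ 'n ^ 'n.
            (\<forall>r. \<forall>x\<in>U. (A *v x) $ r \<ge> 0) \<longrightarrow>
            (\<forall>r. restrict (Y_fun \<alpha> A r) U \<in> lin_span_on U (X_fun \<alpha>)) \<longrightarrow>
            (\<forall>r. card {j. A $ r $ j \<noteq> 0} \<le> 1) \<and>
            (invertible A \<longrightarrow>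
              (\<exists>D P. positive_diagonal D \<and> permutation_matrix P \<and> A = D ** P)))
       \<and> (\<forall>D P :: real ^ 'n ^ 'n. positive_diagonal D \<longrightarrow> permutation_matrix P \<longrightarrow>
            lin_span_on U (Y_fun \<alpha> (D ** P)) = lin_span_on U (X_fun \<alpha>))"
proof (intro conjI allI impI)
  fix A :: "real ^ 'n ^ 'n" and r
  assume "\<forall>r. \<forall>x\<in>U. (A *v x) $ r \<ge> 0"
    and "\<forall>r. restrict (Y_fun \<alpha> A r) U \<in> lin_span_on U (X_fun \<alpha>)"
  then have "p = q" if "A $ r $ p \<noteq> 0" "A $ r $ q \<noteq> 0" for p q
    using row_support_of_powr_in_span[of \<alpha> b A r p q] assms that by blast
  then show "card {j. A $ r $ j \<noteq> 0} \<le> 1"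
    by (simp add: card_le_Suc0_iff_eq)
next
  fix A :: "real ^ 'n ^ 'n"
  assume nonneg: "\<forall>r. \<forall>x\<in>U. (A *v x) $ r \<ge> 0"
    and span: "\<forall>r. restrict (Y_fun \<alpha> A r) U \<in> lin_span_on U (X_fun \<alpha>)"
    and inv: "invertible A"
  from inv show "\<exists>D P. positive_diagonal D \<and> permutation_matrix P \<and> A = D ** P"
  proof (rule invertible_nonneg_monomial_decomposition)
    show "0 \<le> A $ i $ j" for i j
      using row_nonneg_imp_entry_nonneg[of b A i j] assms nonneg by blast
    show "p = q" if "A $ r $ p \<noteq> 0" "A $ r $ q \<noteq> 0" for r p q
      using row_support_of_powr_in_span[of \<alpha> b A r p q] assms nonneg span that by blast
  qed
next
  fix D P :: "real ^ 'n ^ 'n"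
  assume "positive_diagonal D" "permutation_matrix P"
  then show "lin_span_on U (Y_fun \<alpha> (D ** P)) = lin_span_on U (X_fun \<alpha>)"
    by (rule lin_span_on_generalized_permutation) (simp add: assms(4) mem_box_cart)
qed

end
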